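(* The sequence $u_n=\gcd(2^n-1,F_n)$, $n\ge0$, where $(F_n)$ is the Fibonacci sequence ($F_0=0,F_1=1,F_n=F_{n-1}+F_{n-2}$), does not satisfy any linear recurrence (with integer coefficients and nonzero last coefficient). *)

theory Defs
  imports "HOL-Number_Theory.Fib"
begin

definition satisfies_linear_recurrence :: "(nat \<Rightarrow> int) \<Rightarrow> bool" where
  "satisfies_linear_recurrence u \<longleftrightarrow>
     (\<exists>k::nat. \<exists>c::nat \<Rightarrow> int. k \<ge> 1 \<and> c k \<noteq> 0 \<and>
        (\<forall>n. u (n + k) = (\<Sum>i=1..k. c i * u (n + k - i))))"

end

theory Submission
  imports Defs "Jordan_Normal_Form.Determinant"
begin

text \<open>
  Let \<open>u n = gcd (2 ^ n - 1) (fib n)\<close>. It is odd for \<open>n > 0\<close>, whereas \<open>u 0 = 0\<close>. If \<open>u\<close> were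
  recurrent, its Hankel determinants of minimal order would be nonzero integers forming a
  geometric progression. A ratio of absolute value 1 would make \<open>u\<close> purely periodic modulo 2,
  contradicting the parities; hence the ratio exceeds 1 in absolute value, and every window of
  bounded length beyond some point contains an \<open>l\<close> with \<open>u l \<ge> \<rho> ^ s\<close>, where \<open>\<rho> > 1\<close> and \<open>s\<close> is
  the start of the window.

  On the other hand, modulo \<open>u n\<close> both \<open>2 ^ n\<close> and \<open>phi ^ (4 * n)\<close> are congruent to 1. Take such
  indices \<open>l\<close> in consecutive windows near \<open>n\<close>, together with the index 0, and form the
  generalized Vandermonde determinant of the \<open>q\<^sup>2\<close> functions
  \<open>2 ^ (a * l) * phi ^ (4 * b * l)\<close> with \<open>a, b < q\<close>. Its norm is divisible by
  the squares of \<open>q\<^sup>2 - 1\<close> values of \<open>u\<close>, but after removing powers of 2 it is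
  only of size \<open>(4 * phi ^ 4) ^ (n * (q - 1))\<close>, which is impossible for large \<open>q\<close>.
\<close>

subsection \<open>Generalized Vandermonde determinants\<close>

text \<open>Rolle in each gap between consecutive zeros. The bound \<open>t < Max Z\<close> keeps
  the zero found in the last gap distinct from those given by the induction hypothesis.\<close>

lemma exists_zeros_of_derivative:
  fixes f f' :: "real \<Rightarrow> real"
  assumes "finite Z" "card Z = Suc m"
    and "\<And>t. t \<in> Z \<Longrightarrow> f t = 0"
    and deriv: "\<And>t. (f has_real_derivative f' t) (at t)"
  shows "\<exists>Z'. finite Z' \<and> card Z' = m \<and> (\<forall>t\<in>Z'. f' t = 0 \<and> t < Max Z)"
  using assms(1-3)
proof (induction m arbitrary: Z)
  case 0
  then show ?case by (intro exI[of _ "{}"]) auto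
next
  case (Suc m)
  define M where "M = Max Z"
  define Y where "Y = Z - {M}"
  have ne: "Z \<noteq> {}" using Suc.prems by auto
  have M: "M \<in> Z" using Max_in[OF Suc.prems(1) ne] M_def by simp
  have Y: "finite Y" "card Y = Suc m"
    using Suc.prems M by (simp_all add: Y_def)
  have Yne: "Y \<noteq> {}" using Y by auto
  have MY: "Max Y \<in> Y" using Max_in[OF Y(1) Yne] .
  have less: "Max Y < M"
    using MY Max_ge[OF Suc.prems(1), of "Max Y"] by (auto simp: Y_def M_def[symmetric])
  obtain Y' where Y': "finite Y'" "card Y' = m" "\<forall>t\<in>Y'. f' t = 0 \<and> t < Max Y"
    using Suc.IH[OF Y] Suc.prems(3) by (auto simp: Y_def)
  have "\<exists>z>Max Y. z < M \<and> DERIV f z :> 0"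
  proof (rule Rolle[OF less])
    show "f (Max Y) = f M" using Suc.prems(3) M MY by (auto simp: Y_def)
    show "continuous_on {Max Y..M} f"
      using deriv by (meson DERIV_isCont continuous_at_imp_continuous_on)
  qed (use deriv real_differentiable_def in blast)
  then obtain z where z: "Max Y < z" "z < M" "DERIV f z :> 0" by auto
  have "f' z = 0" using DERIV_unique[OF deriv z(3)] .
  moreover have "z \<notin> Y'" using Y'(3) z(1) by force
  ultimately show ?case
    using Y' z less by (intro exI[of _ "insert z Y'"]) (auto simp: M_def[symmetric])
qed

text \<open>Multiplying by \<open>exp (- \<mu> x t)\<close> turns one term into a constant, which the derivative
  kills at the cost of one zero.\<close>

lemma exponential_sum_eq_zero:
  fixes c \<mu> :: "'a \<Rightarrow> real"
  assumes "finite S" "inj_on \<mu> S" "finite Z" "card Z = card S"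
    and "\<And>t. t \<in> Z \<Longrightarrow> (\<Sum>l\<in>S. c l * exp (\<mu> l * t)) = 0"
    and "l \<in> S"
  shows "c l = 0"
  using assms
proof (induction S arbitrary: c \<mu> Z l rule: finite_induct)
  case empty
  then show ?case by simp
next
  case (insert x F)
  define g where "g t = c x + (\<Sum>l\<in>F. c l * exp ((\<mu> l - \<mu> x) * t))" for t
  define g' where "g' t = (\<Sum>l\<in>F. (c l * (\<mu> l - \<mu> x)) * exp ((\<mu> l - \<mu> x) * t))" for t
  have g0: "g t = 0" if "t \<in> Z" for t
  proof -
    have "(\<Sum>l\<in>insert x F. c l * exp (\<mu> l * t)) = exp (\<mu> x * t) * g t"
      using insert.hyps
      by (simp add: g_def algebra_simps sum_distrib_left exp_diff)
    then show ?thesis using insert.prems(4)[OF that] by simp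
  qed
  have "(g has_real_derivative g' t) (at t)" for t
    unfolding g_def g'_def
    by (auto intro!: derivative_eq_intros sum.cong simp: algebra_simps)
  moreover have "card Z = Suc (card F)" using insert by simp
  ultimately obtain Z' where Z': "finite Z'" "card Z' = card F" "\<And>t. t \<in> Z' \<Longrightarrow> g' t = 0"
    using exists_zeros_of_derivative[OF insert.prems(2), of "card F" g g'] g0 by auto
  have F: "c l = 0" if "l \<in> F" for l
  proof -
    have "inj_on (\<lambda>l. \<mu> l - \<mu> x) F"
      using insert.prems(1) by (auto simp: inj_on_def)
    then have "c l * (\<mu> l - \<mu> x) = 0"
      using insert.IH[of "\<lambda>l. \<mu> l - \<mu> x" Z' "\<lambda>l. c l * (\<mu> l - \<mu> x)" l] Z' that
      by (simp add: g'_def)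
    moreover have "\<mu> l \<noteq> \<mu> x" using insert.prems(1) insert.hyps(2) that by (auto simp: inj_on_def)
    ultimately show ?thesis by simp
  qed
  obtain t where "t \<in> Z" using insert by fastforce
  then have "c x = 0" using g0[of t] F by (simp add: g_def)
  then show ?case using F insert.prems(5) by auto
qed

text \<open>A kernel vector would be the coefficient list of a sum of \<open>N\<close> exponentials
  with distinct rates \<open>ln (\<nu> l)\<close> that vanishes at the \<open>N\<close> points
  \<open>t i\<close>.\<close>

lemma det_generalized_vandermonde_nonzero:
  fixes \<nu> :: "nat \<Rightarrow> real" and t :: "nat \<Rightarrow> nat"
  assumes pos: "\<And>l. l < N \<Longrightarrow> \<nu> l > 0"
    and inj: "inj_on \<nu> {..<N}" "inj_on t {..<N}"
  shows "det (mat N N (\<lambda>(i, l). \<nu> l ^ t i)) \<noteq> 0"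
proof
  assume "det (mat N N (\<lambda>(i, l). \<nu> l ^ t i)) = 0"
  then obtain v where v: "v \<in> carrier_vec N" "v \<noteq> 0\<^sub>v N"
    "mat N N (\<lambda>(i, l). \<nu> l ^ t i) *\<^sub>v v = 0\<^sub>v N"
    using det_0_iff_vec_prod_zero[of "mat N N (\<lambda>(i, l). \<nu> l ^ t i)" N] by auto
  have "v $ l = 0" if "l \<in> {..<N}" for l
  proof (rule exponential_sum_eq_zero[of "{..<N}" "\<lambda>l. ln (\<nu> l)" "(\<lambda>i. real (t i)) ` {..<N}" "\<lambda>l. v $ l"])
    show "inj_on (\<lambda>l. ln (\<nu> l)) {..<N}"
      using inj(1) pos by (auto simp: inj_on_def)
    show "card ((\<lambda>i. real (t i)) ` {..<N}) = card {..<N}"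
      using inj(2) by (intro card_image) (auto simp: inj_on_def)
    show "(\<Sum>l<N. v $ l * exp (ln (\<nu> l) * x)) = 0" if "x \<in> (\<lambda>i. real (t i)) ` {..<N}" for x
    proof -
      obtain i where i: "i < N" "x = real (t i)" using \<open>x \<in> _\<close> by auto
      have "0 = (mat N N (\<lambda>(i, l). \<nu> l ^ t i) *\<^sub>v v) $ i" using v i by simp
      also have "\<dots> = (\<Sum>l<N. v $ l * \<nu> l ^ t i)"
        using v(1) i(1) by (auto simp: scalar_prod_def atLeast0LessThan mult.commute intro!: sum.cong)
      also have "\<dots> = (\<Sum>l<N. v $ l * exp (ln (\<nu> l) * x))"
        using pos by (intro sum.cong) (auto simp: i(2) exp_of_nat2_mult)
      finally show ?thesis by simp
    qed
  qed (use that in auto)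
  then have "v = 0\<^sub>v N" using v(1) by (intro eq_vecI) auto
  with v(2) show False ..
qed

subsection \<open>Conjugate pairs in the ring of integers of the golden field\<close>

definition phi :: real where "phi = (1 + sqrt 5) / 2"

definition psi :: real where "psi = (1 - sqrt 5) / 2"

lemma phi_times_psi: "phi * psi = - 1"
  by (simp add: phi_def psi_def field_simps)

lemma phi_squared: "phi * phi = phi + 1"
  by (simp add: phi_def field_simps)

lemma psi_squared: "psi * psi = psi + 1"
  by (simp add: psi_def field_simps)

lemma phi_plus_psi: "phi + psi = 1"
  by (simp add: phi_def psi_def field_simps)

lemma phi_gt_1: "phi > 1"
  by (simp add: phi_def)

lemma phi_pow4_times_psi_pow4: "phi ^ 4 * psi ^ 4 = 1"
  by (simp add: phi_times_psi flip: power_mult_distrib)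

lemma psi_pow4: "psi ^ 4 = 1 / phi ^ 4"
  using phi_pow4_times_psi_pow4 phi_gt_1 by (simp add: field_simps)

lemma psi_pow4_pos: "psi ^ 4 > 0"
  using phi_gt_1 by (simp add: psi_pow4)

text \<open>Says that \<open>x\<close> lies in \<open>\<int>[phi]\<close> and that \<open>y\<close> is its Galois conjugate.\<close>

definition conj_pair :: "real \<Rightarrow> real \<Rightarrow> bool" where
  "conj_pair x y \<longleftrightarrow> (\<exists>a b::int. x = of_int a + of_int b * phi \<and> y = of_int a + of_int b * psi)"

lemma conj_pair_of_int: "conj_pair (of_int a) (of_int a)"
  unfolding conj_pair_def by (rule exI[of _ a], rule exI[of _ 0]) simp

lemma conj_pair_add:
  assumes "conj_pair x y" "conj_pair x' y'"
  shows "conj_pair (x + x') (y + y')"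
proof -
  obtain a b c d :: int where "x = of_int a + of_int b * phi" "y = of_int a + of_int b * psi"
    "x' = of_int c + of_int d * phi" "y' = of_int c + of_int d * psi"
    using assms unfolding conj_pair_def by auto
  then show ?thesis unfolding conj_pair_def
    by (intro exI[of _ "a + c"] exI[of _ "b + d"]) (simp add: algebra_simps)
qed

lemma conj_pair_mult:
  assumes "conj_pair x y" "conj_pair x' y'"
  shows "conj_pair (x * x') (y * y')"
proof -
  obtain a b c d :: int where e: "x = of_int a + of_int b * phi" "y = of_int a + of_int b * psi"
    "x' = of_int c + of_int d * phi" "y' = of_int c + of_int d * psi"
    using assms unfolding conj_pair_def by auto
  have "x * x' = of_int a * of_int c + (of_int a * of_int d + of_int b * of_int c) * phi
      + of_int b * of_int d * (phi * phi)"
    "y * y' = of_int a * of_int c + (of_int a * of_int d + of_int b * of_int c) * psi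
      + of_int b * of_int d * (psi * psi)"
    by (simp_all add: e algebra_simps)
  then show ?thesis unfolding conj_pair_def phi_squared psi_squared
    by (intro exI[of _ "a * c + b * d"] exI[of _ "a * d + b * c + b * d"]) (simp add: algebra_simps)
qed

lemma conj_pair_sum:
  assumes "\<And>i. i \<in> I \<Longrightarrow> conj_pair (f i) (g i)"
  shows "conj_pair (sum f I) (sum g I)"
  using assms
  by (induction I rule: infinite_finite_induct)
     (auto intro: conj_pair_add conj_pair_of_int[of 0, simplified])

lemma conj_pair_prod:
  assumes "\<And>i. i \<in> I \<Longrightarrow> conj_pair (f i) (g i)"
  shows "conj_pair (prod f I) (prod g I)"
  using assms
  by (induction I rule: infinite_finite_induct)
     (auto intro: conj_pair_mult conj_pair_of_int[of 1, simplified])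

lemma conj_pair_power: "conj_pair x y \<Longrightarrow> conj_pair (x ^ n) (y ^ n)"
  using conj_pair_prod[of "{..<n}" "\<lambda>_. x" "\<lambda>_. y"] by simp

lemma conj_pair_phi_psi: "conj_pair phi psi" and conj_pair_psi_phi: "conj_pair psi phi"
proof -
  show "conj_pair phi psi"
    unfolding conj_pair_def by (rule exI[of _ 0], rule exI[of _ 1]) simp
  show "conj_pair psi phi"
    unfolding conj_pair_def using phi_plus_psi
    by (intro exI[of _ 1] exI[of _ "-1"]) simp
qed

text \<open>By the Leibniz formula a determinant is an integer polynomial in its entries, so
  conjugation commutes with it.\<close>

lemma conj_pair_det:
  assumes "\<And>i j. i < N \<Longrightarrow> j < N \<Longrightarrow> conj_pair (f (i, j)) (g (i, j))"
  shows "conj_pair (det (mat N N f)) (det (mat N N g))"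
proof -
  have "conj_pair (\<Sum>p | p permutes {0..<N}. signof p * (\<Prod>i = 0..<N. mat N N f $$ (i, p i)))
     (\<Sum>p | p permutes {0..<N}. signof p * (\<Prod>i = 0..<N. mat N N g $$ (i, p i)))"
  proof (intro conj_pair_sum conj_pair_mult conj_pair_prod)
    fix p i assume "p \<in> {p. p permutes {0..<N}}" "i \<in> {0..<N}"
    then have "p i < N" "i < N" using permutes_in_image[of p "{0..<N}" i] by auto
    then show "conj_pair (mat N N f $$ (i, p i)) (mat N N g $$ (i, p i))"
      using assms by simp
  next
    fix p :: "nat \<Rightarrow> nat"
    show "conj_pair (signof p) (signof p)" by (rule conj_pair_of_int)
  qed
  then show ?thesis by (subst (1 2) det_def'[of _ N]) auto
qed

text \<open>Source of the lower bound in the main estimate: a nonzero norm has absolute value at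
  least 1.\<close>

lemma conj_pair_norm_Ints:
  assumes "conj_pair x y"
  shows "x * y \<in> \<int>"
proof -
  obtain a b :: int where "x = of_int a + of_int b * phi" "y = of_int a + of_int b * psi"
    using assms unfolding conj_pair_def by auto
  then have "x * y = of_int a * of_int a + of_int a * of_int b * (phi + psi)
    + of_int b * of_int b * (phi * psi)" by (simp add: algebra_simps)
  also have "\<dots> = of_int (a * a + a * b - b * b)"
    by (simp add: phi_plus_psi phi_times_psi)
  finally show ?thesis by simp
qed

lemma conj_pair_trace_Ints:
  assumes "conj_pair x y"
  shows "x + y \<in> \<int>"
proof -
  obtain a b :: int where "x = of_int a + of_int b * phi" "y = of_int a + of_int b * psi"
    using assms unfolding conj_pair_def by auto
  then have "x + y = of_int a + of_int a + of_int b * (phi + psi)" by (simp add: algebra_simps)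
  then show ?thesis by (simp add: phi_plus_psi)
qed

text \<open>Bezout: \<open>s * a + t * b = 1\<close> writes \<open>z / (a * b)\<close> as an
  integral combination of \<open>z / b\<close> and \<open>z / a\<close>. It will combine
  divisibility by a power of 2 with divisibility by a product of odd \<open>u i\<close>.\<close>

lemma conj_pair_divide_coprime:
  assumes "coprime a (b::int)" "a \<noteq> 0" "b \<noteq> 0"
    and a: "conj_pair (x / of_int a) (y / of_int a)" and b: "conj_pair (x / of_int b) (y / of_int b)"
  shows "conj_pair (x / (of_int a * of_int b)) (y / (of_int a * of_int b))"
proof -
  obtain s t where "s * a + t * b = 1"
    using assms(1) by (metis bezout_int coprime_imp_gcd_eq_1)
  then have st: "of_int s * of_int a + of_int t * of_int b = (1::real)"
    by (metis of_int_1 of_int_add of_int_mult)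
  have "z / (of_int a * of_int b) = of_int s * (z / of_int b) + of_int t * (z / of_int a)" for z :: real
  proof -
    have "z / (of_int a * of_int b)
        = z * (of_int s * of_int a + of_int t * of_int b) / (of_int a * of_int b)" by (simp add: st)
    also have "\<dots> = of_int s * (z / of_int b) + of_int t * (z / of_int a)"
      using assms(2,3) by (simp add: field_simps)
    finally show ?thesis .
  qed
  then show ?thesis
    using conj_pair_add conj_pair_mult conj_pair_of_int a b by metis
qed

section \<open>Congruences to 1 modulo \<open>u\<close>, encoded as integrality of
  \<open>(x - 1) / u\<close>\<close>

lemma conj_pair_cong_1_mult:
  assumes "conj_pair x y" "conj_pair ((x - 1) / u) ((y - 1) / u)" "conj_pair ((x' - 1) / u) ((y' - 1) / u)"
  shows "conj_pair ((x * x' - 1) / u) ((y * y' - 1) / u)"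
proof -
  have "(z * z' - 1) / u = z * ((z' - 1) / u) + (z - 1) / u" for z z' :: real
    by (simp add: algebra_simps diff_divide_distrib)
  then show ?thesis using assms conj_pair_add conj_pair_mult by metis
qed

lemma conj_pair_cong_1_power:
  assumes "conj_pair x y" "conj_pair ((x - 1) / u) ((y - 1) / u)"
  shows "conj_pair ((x ^ n - 1) / u) ((y ^ n - 1) / u)"
proof (induction n)
  case 0
  then show ?case using conj_pair_of_int[of 0] by simp
next
  case (Suc n)
  then show ?case using conj_pair_cong_1_mult[OF assms(1,2) Suc] by simp
qed

lemma phi_pow_minus_psi_pow: "phi ^ n - psi ^ n = sqrt 5 * fib n"
  by (simp add: fib_closed_form phi_def psi_def)

text \<open>\<open>phi ^ (4 * t) - 1 = phi ^ (2 * t) * (phi ^ t + psi ^ t) * (phi ^ t - psi ^ t)\<close>,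
  whose last factor is \<open>sqrt 5 * fib t\<close>.\<close>

lemma conj_pair_phi_cong_1:
  assumes "u dvd fib t" "u > 0"
  shows "conj_pair (((phi ^ 4) ^ t - 1) / u) (((psi ^ 4) ^ t - 1) / u)"
proof -
  obtain v where v: "fib t = u * v" using assms(1) by (auto elim: dvdE)
  have pow: "z ^ (2 * t) = (z ^ t)\<^sup>2" "z ^ (4 * t) = (z ^ t) ^ 4" for z :: real
    by (simp_all add: mult.commute flip: power_mult)
  \<comment> \<open>\<open>sqrt 5 = 2 * phi - 1\<close>, which gives the witnesses -1 and 2.\<close>
  have s5: "conj_pair (sqrt 5) (- sqrt 5)"
    unfolding conj_pair_def
    by (rule exI[of _ "-1"], rule exI[of _ 2]) (simp add: phi_def psi_def field_simps)
  have "conj_pair (phi ^ (2 * t) * ((phi ^ t + psi ^ t) * (sqrt 5 * of_int (int v))))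
     (psi ^ (2 * t) * ((psi ^ t + phi ^ t) * (- sqrt 5 * of_int (int v))))"
    by (intro conj_pair_mult conj_pair_add conj_pair_power conj_pair_phi_psi conj_pair_psi_phi s5
        conj_pair_of_int)
  moreover have "phi ^ (2 * t) * ((phi ^ t + psi ^ t) * (sqrt 5 * of_int (int v))) = ((phi ^ 4) ^ t - 1) / u"
  proof -
    have "u * (phi ^ (2 * t) * ((phi ^ t + psi ^ t) * (sqrt 5 * of_int (int v))))
      = phi ^ (2 * t) * ((phi ^ t + psi ^ t) * (phi ^ t - psi ^ t))"
      by (simp add: phi_pow_minus_psi_pow v)
    \<comment> \<open>The even exponent \<open>2 * t\<close> turns the power of
      \<open>phi * psi = - 1\<close> into 1 whatever the parity of \<open>t\<close>.\<close>
    also have "\<dots> = phi ^ (4 * t) - (phi * psi) ^ (2 * t)"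
      by (simp add: pow power_mult_distrib) (simp add: algebra_simps eval_nat_numeral)
    also have "\<dots> = (phi ^ 4) ^ t - 1" by (simp add: phi_times_psi power_mult)
    finally show ?thesis using assms(2) by (simp add: field_simps)
  qed
  moreover have "psi ^ (2 * t) * ((psi ^ t + phi ^ t) * (- sqrt 5 * of_int (int v))) = ((psi ^ 4) ^ t - 1) / u"
  proof -
    have "u * (psi ^ (2 * t) * ((psi ^ t + phi ^ t) * (- sqrt 5 * of_int (int v))))
      = psi ^ (2 * t) * ((psi ^ t + phi ^ t) * - (phi ^ t - psi ^ t))"
      by (simp add: phi_pow_minus_psi_pow v)
    also have "\<dots> = psi ^ (4 * t) - (phi * psi) ^ (2 * t)"
      by (simp add: pow power_mult_distrib) (simp add: algebra_simps eval_nat_numeral)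
    also have "\<dots> = (psi ^ 4) ^ t - 1" by (simp add: phi_times_psi power_mult)
    finally show ?thesis using assms(2) by (simp add: field_simps)
  qed
  ultimately show ?thesis by simp
qed

lemma conj_pair_two_cong_1:
  assumes "u dvd 2 ^ t - (1::nat)" "u > 0"
  shows "conj_pair ((2 ^ t - 1) / u) ((2 ^ t - 1) / u)"
proof -
  obtain v where v: "2 ^ t - 1 = u * v" using assms(1) by (auto elim: dvdE)
  have "real (2 ^ t - 1) = real u * real v" unfolding v by simp
  then have "2 ^ t - 1 = real u * real v" by (simp add: of_nat_diff)
  then have "(2 ^ t - 1) / u = (of_int (int v) :: real)" using assms(2) by (simp add: field_simps)
  then show ?thesis using conj_pair_of_int by metis
qed

text \<open>Cancelling leaves \<open>phi ^ (4 * d) = 2 ^ e\<close> with \<open>d, e > 0\<close>. The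
  conjugate of the left side is its inverse, so the trace \<open>2 ^ e + 1 / 2 ^ e\<close> would
  have to be an integer.\<close>

lemma two_phi_independent_aux:
  assumes "2 ^ a * (phi ^ 4) ^ b = 2 ^ a' * (phi ^ 4) ^ b'" "b' < b"
  shows False
proof -
  define d where "d = b - b'"
  define x where "x = (phi ^ 4) ^ d"
  have "d > 0" using assms(2) by (simp add: d_def)
  have x1: "x > 1" using phi_gt_1 \<open>d > 0\<close> by (auto simp: x_def intro!: one_less_power)
  have "b = d + b'" using assms(2) by (simp add: d_def)
  then have "2 ^ a * x * (phi ^ 4) ^ b' = 2 ^ a' * (phi ^ 4) ^ b'"
    using assms(1) by (simp add: power_add x_def)
  then have eq: "2 ^ a * x = 2 ^ a'" using phi_gt_1 by simp
  have "(2::real) ^ a < 2 ^ a'"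
    using x1 by (simp flip: eq)
  then have aa: "a < a'" by simp
  define e where "e = a' - a"
  have "e > 0" "a' = a + e" using aa by (simp_all add: e_def)
  then have x: "x = 2 ^ e" using eq by (simp add: power_add)
  have "conj_pair x ((psi ^ 4) ^ d)"
    unfolding x_def by (intro conj_pair_power conj_pair_phi_psi)
  moreover have "(psi ^ 4) ^ d = 1 / x" by (simp add: psi_pow4 x_def power_divide)
  ultimately have "x + 1 / x \<in> \<int>" using conj_pair_trace_Ints by metis
  then obtain L where "2 ^ e + 1 / 2 ^ e = (of_int L :: real)" by (metis Ints_cases x)
  then have "2 ^ e * 2 ^ e + 1 = of_int L * (2 ^ e :: real)"
    by (simp add: field_simps)
  then have "of_int (2 ^ e * 2 ^ e + 1) = (of_int (L * 2 ^ e) :: real)" by simp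
  then have "(2::int) ^ e * 2 ^ e + 1 = L * 2 ^ e" by (simp only: of_int_eq_iff)
  then have "even ((2::int) ^ e * 2 ^ e + 1)" using \<open>e > 0\<close> by simp
  then show False using \<open>e > 0\<close> by simp
qed

lemma two_phi_independent:
  assumes "2 ^ a * (phi ^ 4) ^ b = 2 ^ a' * (phi ^ 4) ^ b'"
  shows "a = a' \<and> b = b'"
proof -
  have "b = b'"
    using two_phi_independent_aux[OF assms] two_phi_independent_aux[OF assms[symmetric]]
    by (meson linorder_neqE_nat)
  moreover from this have "(2::real) ^ a = 2 ^ a'" using assms phi_gt_1 by simp
  ultimately show ?thesis by simp
qed

subsection \<open>The norm of the determinant\<close>

text \<open>Controls the exponents in the Leibniz expansion: row 0 has exponent 0 and so loses at
  most one weight \<open>m\<close>, while every other row contributes its weight between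
  \<open>n\<close> and \<open>n + R\<close> times.\<close>

lemma weighted_exponent_bounds:
  fixes w t p :: "nat \<Rightarrow> nat"
  assumes p: "p permutes {0..<N}" and "N > 0" and t0: "t 0 = 0"
    and t: "\<And>i. i \<in> {1..<N} \<Longrightarrow> n \<le> t i \<and> t i \<le> n + R"
    and w: "\<And>l. l < N \<Longrightarrow> w l \<le> m"
  shows "n * (sum w {0..<N} - m) \<le> (\<Sum>i = 0..<N. w (p i) * t i)"
    and "(\<Sum>i = 0..<N. w (p i) * t i) \<le> (n + R) * sum w {0..<N}"
proof -
  have perm: "(\<Sum>i = 0..<N. w (p i)) = sum w {0..<N}"
    using sum.permute[OF p, of w] by (simp add: comp_def)
  have split: "(\<Sum>i = 0..<N. f i) = f 0 + (\<Sum>i = 1..<N. f i)" for f :: "nat \<Rightarrow> nat"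
    using \<open>N > 0\<close> by (simp add: sum.atLeast_Suc_lessThan)
  have "w (p 0) \<le> m"
    using w[of "p 0"] permutes_in_image[OF p, of 0] \<open>N > 0\<close> by auto
  then have "sum w {0..<N} - m \<le> (\<Sum>i = 1..<N. w (p i))"
    using split[of "\<lambda>i. w (p i)"] perm by linarith
  then have "n * (sum w {0..<N} - m) \<le> (\<Sum>i = 1..<N. w (p i) * n)"
    by (simp add: mult.commute flip: sum_distrib_left)
  also have "\<dots> \<le> (\<Sum>i = 1..<N. w (p i) * t i)"
    using t by (intro sum_mono mult_mono) auto
  also have "\<dots> \<le> (\<Sum>i = 0..<N. w (p i) * t i)"
    unfolding split[of "\<lambda>i. w (p i) * t i"] by simp
  finally show "n * (sum w {0..<N} - m) \<le> (\<Sum>i = 0..<N. w (p i) * t i)" .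
  have "(\<Sum>i = 0..<N. w (p i) * t i) \<le> (\<Sum>i = 0..<N. w (p i) * (n + R))"
  proof (intro sum_mono mult_left_mono)
    fix i assume "i \<in> {0..<N}"
    then show "t i \<le> n + R" using t[of i] t0 by (cases "i = 0") auto
  qed auto
  also have "\<dots> = (n + R) * sum w {0..<N}"
    by (simp add: mult.commute perm flip: sum_distrib_left)
  finally show "(\<Sum>i = 0..<N. w (p i) * t i) \<le> (n + R) * sum w {0..<N}" .
qed

lemma abs_signed_permutation_sum_le:
  fixes g :: "(nat \<Rightarrow> nat) \<Rightarrow> real"
  assumes "\<And>p. p permutes {0..<N} \<Longrightarrow> \<bar>g p\<bar> \<le> B"
  shows "\<bar>\<Sum>p | p permutes {0..<N}. signof p * g p\<bar> \<le> fact N * B"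
proof -
  have "\<bar>\<Sum>p | p permutes {0..<N}. signof p * g p\<bar> \<le> (\<Sum>p | p permutes {0..<N}. \<bar>signof p * g p\<bar>)"
    by (rule sum_abs)
  also have "\<dots> \<le> (\<Sum>p | p permutes {0..<N}. B)"
    using assms by (intro sum_mono) (auto simp: abs_mult sign_def)
  also have "\<dots> = fact N * B"
    by (simp add: card_permutations)
  finally show ?thesis .
qed

lemma det_subtract_row_0:
  fixes m :: "nat \<Rightarrow> nat \<Rightarrow> real"
  assumes "N > 0" and u: "\<And>i. i \<in> {1..<N} \<Longrightarrow> u i > 0"
    and row0: "\<And>l. l < N \<Longrightarrow> m 0 l = 1"
  shows "det (mat N N (\<lambda>(i, l). m i l))
    = (\<Prod>i\<in>{1..<N}. u i) * det (mat N N (\<lambda>(i, l). if i = 0 then 1 else (m i l - 1) / u i))"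
proof -
  \<comment> \<open>\<open>T\<close> undoes the row operation: it multiplies row \<open>i\<close> by
    \<open>u i\<close> and adds row 0 back. It is lower triangular with diagonal 1,
    \<open>u 1\<close>, \<open>u 2\<close> and so on.\<close>
  define T where "T = mat N N (\<lambda>(i, j). if i = j then (if i = 0 then 1 else u i) else if j = 0 then 1 else (0::real))"
  define Q where "Q = mat N N (\<lambda>(i, l). if i = 0 then 1 else (m i l - 1) / u i)"
  have cT: "T \<in> carrier_mat N N" and cQ: "Q \<in> carrier_mat N N" by (simp_all add: T_def Q_def)
  have "mat N N (\<lambda>(i, l). m i l) = T * Q"
  proof (rule eq_matI)
    fix i l assume "i < dim_row (T * Q)" "l < dim_col (T * Q)"
    then have il: "i < N" "l < N" using cT cQ by auto
    have "(T * Q) $$ (i, l) = (\<Sum>j = 0..<N. T $$ (i, j) * Q $$ (j, l))"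
      using il cT cQ by (auto simp: scalar_prod_def)
    also have "\<dots> = (\<Sum>j\<in>{0, i}. T $$ (i, j) * Q $$ (j, l))"
      using il by (intro sum.mono_neutral_right) (auto simp: T_def)
    also have "\<dots> = m i l"
    proof (cases "i = 0")
      case True
      then show ?thesis using il row0 by (simp add: T_def Q_def)
    next
      case False
      then show ?thesis using il u[of i] by (simp add: T_def Q_def)
    qed
    finally show "mat N N (\<lambda>(i, l). m i l) $$ (i, l) = (T * Q) $$ (i, l)" using il by simp
  qed (use cT cQ in auto)
  then have "det (mat N N (\<lambda>(i, l). m i l)) = det T * det Q"
    using det_mult[OF cT cQ] by simp
  also have "det T = prod_list (diag_mat T)"
    by (rule det_lower_triangular[OF _ cT]) (auto simp: T_def)
  also have "\<dots> = (\<Prod>i = 0..<N. T $$ (i, i))"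
    by (simp add: prod_list_diag_prod T_def)
  also have "\<dots> = (\<Prod>i\<in>{1..<N}. u i)"
    using \<open>N > 0\<close> by (simp add: prod.atLeast_Suc_lessThan T_def)
  finally show ?thesis by (simp add: Q_def)
qed

text \<open>The generalized Vandermonde determinant with bases \<open>2 ^ a * phi ^ (4 * b)\<close> and exponents \<open>t i\<close>
  is a nonzero element of \<open>\<int>[phi]\<close>. Since \<open>t 0 = 0\<close>, subtracting row \<open>0\<close> makes every other row \<open>i\<close>
  divisible by \<open>u i\<close>; in the norm the powers of \<open>phi\<close> nearly cancel, and
  those of 2 are compensated by the divisibility by 2.\<close>

proposition prod_common_divisors_bound:
  fixes q n R :: nat and t u :: "nat \<Rightarrow> nat"
  defines "N \<equiv> q * q"
  defines "S \<equiv> \<Sum>l = 0..<N. l div q" and "S' \<equiv> \<Sum>l = 0..<N. l mod q"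
  assumes q: "q > 0" and t0: "t 0 = 0" and inj: "inj_on t {..<N}"
    and t: "\<And>i. i \<in> {1..<N} \<Longrightarrow> n \<le> t i \<and> t i \<le> n + R"
    and u: "\<And>i. i \<in> {1..<N} \<Longrightarrow> u i > 0 \<and> odd (u i) \<and> u i dvd 2 ^ t i - 1 \<and> u i dvd fib (t i)"
  shows "(\<Prod>i\<in>{1..<N}. real (u i))\<^sup>2
    \<le> (fact N)\<^sup>2 * 4 ^ (R * S) * (phi ^ 4) ^ (R * S') * (4 * phi ^ 4) ^ (n * (q - 1))"
proof -
  define \<theta> \<theta>' where "\<theta> = phi ^ 4" and "\<theta>' = psi ^ 4"
  have th: "\<theta> \<ge> 1" "\<theta>' > 0" "\<theta> * \<theta>' = 1" "\<theta>' = 1 / \<theta>"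
    using phi_gt_1 psi_pow4_pos phi_pow4_times_psi_pow4 psi_pow4 by (auto simp: \<theta>_def \<theta>'_def)
  have N: "N > 0" using q by (simp add: N_def)
  have th'1: "\<theta>' \<le> 1" using th by simp
  \<comment> \<open>The base-\<open>q\<close> digits of the column index enumerate all pairs of
    exponents below \<open>q\<close>.\<close>
  define \<nu> \<nu>' where "\<nu> l = 2 ^ (l div q) * \<theta> ^ (l mod q)"
    and "\<nu>' l = 2 ^ (l div q) * \<theta>' ^ (l mod q)" for l
  define V V' where "V = det (mat N N (\<lambda>(i, l). \<nu> l ^ t i))"
    and "V' = det (mat N N (\<lambda>(i, l). \<nu>' l ^ t i))"
  \<comment> \<open>\<open>e\<close> and \<open>f\<close> are lower bounds for the exponents of 2
    and of \<open>\<theta>\<close> in every Leibniz term.\<close>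
  define e where "e = n * (S - (q - 1))"
  define f where "f = n * (S' - (q - 1))"
  define U where "U = (\<Prod>i\<in>{1..<N}. u i)"
  have digits: "l = l'" if "l div q = l' div q" "l mod q = l' mod q" for l l'
    using that by (metis div_mult_mod_eq)
  have "V \<noteq> 0" unfolding V_def
  proof (rule det_generalized_vandermonde_nonzero)
    show "inj_on \<nu> {..<N}"
      by (rule inj_onI) (metis two_phi_independent digits \<nu>_def \<theta>_def)
  qed (use th inj in \<open>auto simp: \<nu>_def\<close>)
  have "V' \<noteq> 0" unfolding V'_def
  proof (rule det_generalized_vandermonde_nonzero)
    show "inj_on \<nu>' {..<N}"
    proof (rule inj_onI)
      fix l l' assume "\<nu>' l = \<nu>' l'"
      \<comment> \<open>As \<open>\<theta>' = 1 / \<theta>\<close>, clearing denominators swaps the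
        two exponents of \<open>\<theta>\<close>.\<close>
      then have "2 ^ (l div q) * \<theta> ^ (l' mod q) = 2 ^ (l' div q) * \<theta> ^ (l mod q)"
        using th by (simp add: \<nu>'_def power_divide field_simps)
      then show "l = l'" using two_phi_independent digits \<theta>_def by metis
    qed
  qed (use th inj in \<open>auto simp: \<nu>'_def\<close>)

  define E where "E p = (\<Sum>i = 0..<N. p i div q * t i)" for p
  define E' where "E' p = (\<Sum>i = 0..<N. p i mod q * t i)" for p
  have E: "e \<le> E p" "E p \<le> (n + R) * S" and E': "f \<le> E' p" "E' p \<le> (n + R) * S'"
    if p: "p permutes {0..<N}" for p
  proof -
    have "l div q \<le> q - 1" if "l < N" for l
      using that q less_mult_imp_div_less[of l q q] by (simp add: N_def)
    then show "e \<le> E p" "E p \<le> (n + R) * S"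
      using weighted_exponent_bounds[where w = "\<lambda>l. l div q" and m = "q - 1" and t = t, OF p N t0 t]
      by (auto simp: e_def E_def S_def)
    have "l mod q \<le> q - 1" for l
      using q mod_less_divisor[of q l] by linarith
    then show "f \<le> E' p" "E' p \<le> (n + R) * S'"
      using weighted_exponent_bounds[where w = "\<lambda>l. l mod q" and m = "q - 1" and t = t, OF p N t0 t]
      by (auto simp: f_def E'_def S'_def)
  qed
  have leibniz: "det (mat N N (\<lambda>(i, l). (2 ^ (l div q) * z ^ (l mod q)) ^ t i))
      = (\<Sum>p | p permutes {0..<N}. signof p * (2 ^ E p * z ^ E' p))" for z :: real
  proof -
    have "(\<Prod>i = 0..<N. mat N N (\<lambda>(i, l). (2 ^ (l div q) * z ^ (l mod q)) ^ t i) $$ (i, p i))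
        = 2 ^ E p * z ^ E' p" if "p permutes {0..<N}" for p
    proof -
      have "p i < N" if "i < N" for i using permutes_in_image[OF \<open>p permutes _\<close>, of i] that by simp
      then have "(\<Prod>i = 0..<N. mat N N (\<lambda>(i, l). (2 ^ (l div q) * z ^ (l mod q)) ^ t i) $$ (i, p i))
          = (\<Prod>i = 0..<N. 2 ^ (p i div q * t i) * z ^ (p i mod q * t i))"
        by (intro prod.cong) (auto simp: power_mult_distrib power_mult)
      then show ?thesis by (simp add: E_def E'_def power_sum prod.distrib)
    qed
    then show ?thesis by (subst det_def'[of _ N]) (auto intro!: sum.cong)
  qed
  have V: "V = (\<Sum>p | p permutes {0..<N}. signof p * (2 ^ E p * \<theta> ^ E' p))"
    and V': "V' = (\<Sum>p | p permutes {0..<N}. signof p * (2 ^ E p * \<theta>' ^ E' p))"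
    unfolding V_def V'_def \<nu>_def \<nu>'_def by (rule leibniz)+

  have "\<bar>V\<bar> \<le> fact N * (2 ^ ((n + R) * S) * \<theta> ^ ((n + R) * S'))" unfolding V
    using E E' th
    by (intro abs_signed_permutation_sum_le) (auto simp: abs_mult intro!: mult_mono power_increasing)
  \<comment> \<open>Since \<open>\<theta>' \<le> 1\<close>, it is the lower bound \<open>f\<close>
    on the exponent that bounds these terms from above.\<close>
  moreover have "\<bar>V'\<bar> \<le> fact N * (2 ^ ((n + R) * S) * \<theta>' ^ f)" unfolding V'
    using E E' th th'1
    by (intro abs_signed_permutation_sum_le) 
       (auto simp: abs_mult intro!: mult_mono power_increasing[of _ _ 2] power_decreasing)
  ultimately have "\<bar>V * V'\<bar> \<le> (fact N * (2 ^ ((n + R) * S) * \<theta> ^ ((n + R) * S')))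
      * (fact N * (2 ^ ((n + R) * S) * \<theta>' ^ f))"
    unfolding abs_mult by (intro mult_mono) (use th in auto)
  also have "\<dots> = (fact N)\<^sup>2 * 4 ^ ((n + R) * S) * (\<theta> ^ ((n + R) * S') * \<theta>' ^ f)"
    by (simp add: power2_eq_square algebra_simps flip: power_mult_distrib)
  \<comment> \<open>\<open>\<theta> * \<theta>' = 1\<close> cancels \<open>f\<close> powers of
    \<open>\<theta>\<close>; \<open>4 ^ e\<close> is split off to be cancelled by the division by
    \<open>2 ^ e\<close> of both determinants. Only an inequality, because the subtractions in
    \<open>e\<close> and \<open>f\<close> are truncated.\<close>
  also have "\<dots> \<le> (fact N)\<^sup>2 * 4 ^ (e + R * S + n * (q - 1)) * \<theta> ^ (R * S' + n * (q - 1))"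
  proof (intro mult_mono)
    have "(n + R) * S \<le> e + R * S + n * (q - 1)"
      unfolding e_def by (simp add: algebra_simps flip: add_mult_distrib2)
    then show "(4::real) ^ ((n + R) * S) \<le> 4 ^ (e + R * S + n * (q - 1))"
      by (intro power_increasing) auto
    have "(n + R) * S' \<le> f + (R * S' + n * (q - 1))"
      unfolding f_def by (simp add: algebra_simps flip: add_mult_distrib2)
    then have "\<theta> ^ ((n + R) * S') * \<theta>' ^ f \<le> \<theta> ^ (f + (R * S' + n * (q - 1))) * \<theta>' ^ f"
      using th by (intro mult_right_mono power_increasing) auto
    also have "\<dots> = \<theta> ^ (R * S' + n * (q - 1)) * (\<theta> * \<theta>') ^ f"
      by (simp add: power_add power_mult_distrib)
    finally show "\<theta> ^ ((n + R) * S') * \<theta>' ^ f \<le> \<theta> ^ (R * S' + n * (q - 1))"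
      by (simp add: th(3))
  qed (use th in auto)
  finally have upper: "\<bar>V * V'\<bar> \<le> 4 ^ e * ((fact N)\<^sup>2 * 4 ^ (R * S) * \<theta> ^ (R * S') * (4 * \<theta>) ^ (n * (q - 1)))"
    by (simp add: power_add power_mult_distrib algebra_simps)

  have cp_\<theta>: "conj_pair \<theta> \<theta>'"
    unfolding \<theta>_def \<theta>'_def by (intro conj_pair_power conj_pair_phi_psi)
  have cp_2: "conj_pair (2 ^ k) (2 ^ k)" for k
    using conj_pair_of_int[of "2 ^ k"] by simp
  have "conj_pair (V / of_int (2 ^ e)) (V' / of_int (2 ^ e))"
  proof -
    have "(\<Sum>p | p permutes {0..<N}. signof p * (2 ^ E p * z ^ E' p)) / of_int (2 ^ e)
       = (\<Sum>p | p permutes {0..<N}. signof p * (2 ^ (E p - e) * z ^ E' p))" for z :: real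
      unfolding sum_divide_distrib using E by (intro sum.cong) (auto simp: power_diff)
    then show ?thesis unfolding V V'
      by (simp only:) (intro conj_pair_sum conj_pair_mult conj_pair_of_int cp_2 conj_pair_power cp_\<theta>)
  qed
  moreover have "conj_pair (V / of_int (int U)) (V' / of_int (int U))"
  proof -
    \<comment> \<open>The determinant after row subtraction. Its entries are integral because
      \<open>2 ^ t i\<close> and \<open>\<theta> ^ t i\<close> are both congruent to 1 modulo
      \<open>u i\<close>.\<close>
    define W where "W z = det (mat N N (\<lambda>(i, l). if i = 0 then 1 else
      ((2 ^ (l div q) * z ^ (l mod q)) ^ t i - 1) / real (u i)))" for z :: real
    have "det (mat N N (\<lambda>(i, l). (2 ^ (l div q) * z ^ (l mod q)) ^ t i)) = real U * W z" for z :: real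
      unfolding W_def U_def of_nat_prod
      by (rule det_subtract_row_0[OF N]) (use u t0 in auto)
    moreover have "U > 0" using u by (auto simp: U_def intro!: prod_pos)
    ultimately have "V / of_int (int U) = W \<theta>" "V' / of_int (int U) = W \<theta>'"
      by (simp_all add: V_def V'_def \<nu>_def \<nu>'_def)
    moreover have "conj_pair (W \<theta>) (W \<theta>')" unfolding W_def
    proof (rule conj_pair_det)
      fix i l assume il: "i < N" "l < N"
      show "conj_pair
        (case (i, l) of (i, l) \<Rightarrow> if i = 0 then 1 else ((2 ^ (l div q) * \<theta> ^ (l mod q)) ^ t i - 1) / real (u i))
        (case (i, l) of (i, l) \<Rightarrow> if i = 0 then 1 else ((2 ^ (l div q) * \<theta>' ^ (l mod q)) ^ t i - 1) / real (u i))"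
      proof (cases "i = 0")
        case True
        then show ?thesis using conj_pair_of_int[of 1] by simp
      next
        case False
        then have ui: "u i > 0" "u i dvd 2 ^ t i - 1" "u i dvd fib (t i)" using u[of i] il by auto
        have "conj_pair (((2 ^ t i) ^ (l div q) * (\<theta> ^ t i) ^ (l mod q) - 1) / real (u i))
          (((2 ^ t i) ^ (l div q) * (\<theta>' ^ t i) ^ (l mod q) - 1) / real (u i))"
          using conj_pair_cong_1_mult[OF conj_pair_power[OF cp_2] conj_pair_cong_1_power[OF cp_2
              conj_pair_two_cong_1[OF ui(2,1)]] conj_pair_cong_1_power[OF conj_pair_power[OF cp_\<theta>]
              conj_pair_phi_cong_1[OF ui(3,1), folded \<theta>_def \<theta>'_def]]] .
        then show ?thesis using False
          by (simp add: power_mult_distrib mult.commute flip: power_mult)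
      qed
    qed
    ultimately show ?thesis by simp
  qed
  moreover have "coprime (2 ^ e) (int U)"
  proof -
    have "odd U" unfolding U_def using u by (subst even_prod_iff) auto
    then show ?thesis by (simp add: coprime_left_2_iff_odd)
  qed
  moreover have U0: "U > 0" using u by (auto simp: U_def intro!: prod_pos)
  ultimately have "conj_pair (V / (of_int (2 ^ e) * of_int (int U))) (V' / (of_int (2 ^ e) * of_int (int U)))"
    by (intro conj_pair_divide_coprime) auto
  then have "V / (of_int (2 ^ e) * of_int (int U)) * (V' / (of_int (2 ^ e) * of_int (int U))) \<in> \<int>"
    by (rule conj_pair_norm_Ints)
  then have "1 \<le> \<bar>V / (of_int (2 ^ e) * of_int (int U)) * (V' / (of_int (2 ^ e) * of_int (int U)))\<bar>"
    using \<open>V \<noteq> 0\<close> \<open>V' \<noteq> 0\<close> U0 by (intro Ints_nonzero_abs_ge1) auto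
  also have "\<dots> = \<bar>V * V'\<bar> / (4 ^ e * (real U)\<^sup>2)"
    by (simp add: abs_mult power2_eq_square field_simps flip: power_mult_distrib)
  finally have "4 ^ e * (real U)\<^sup>2 \<le> \<bar>V * V'\<bar>"
    using U0 by (simp add: field_simps)
  with upper have "4 ^ e * (real U)\<^sup>2 \<le>
      4 ^ e * ((fact N)\<^sup>2 * 4 ^ (R * S) * \<theta> ^ (R * S') * (4 * \<theta>) ^ (n * (q - 1)))"
    by (rule order_trans[rotated])
  then show ?thesis by (simp add: U_def \<theta>_def)
qed

subsection \<open>Growth of recurrent sequences via Hankel determinants\<close>

definition annihilates :: "nat \<Rightarrow> (nat \<Rightarrow> real) \<Rightarrow> (nat \<Rightarrow> real) \<Rightarrow> bool" where
  "annihilates k v y \<longleftrightarrow> (\<forall>n. (\<Sum>j\<le>k. v j * y (n + j)) = 0)"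

text \<open>Recurrences are linear and shift invariant. The shifts \<open>s\<close> are arbitrary so
  that far-away terms can be compared with terms near index 0.\<close>

lemma annihilates_shift_combination:
  assumes "annihilates k v y"
  shows "annihilates k v (\<lambda>m. \<Sum>j\<in>J. w j * y (m + s j))"
  unfolding annihilates_def
proof
  fix n
  have "(\<Sum>i\<le>k. v i * (\<Sum>j\<in>J. w j * y (n + i + s j)))
      = (\<Sum>j\<in>J. w j * (\<Sum>i\<le>k. v i * y ((n + s j) + i)))"
    unfolding sum_distrib_left by (subst sum.swap) (simp add: ac_simps)
  also have "\<dots> = 0" using assms unfolding annihilates_def by (simp del: add.assoc)
  finally show "(\<Sum>i\<le>k. v i * (\<Sum>j\<in>J. w j * y (n + i + s j))) = 0" .
qed

lemma annihilates_zero_forward: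
  assumes "annihilates k v y" "v k \<noteq> 0" "\<And>i. i < k \<Longrightarrow> y (m + i) = 0"
  shows "y (m + i) = 0"
proof (induction i rule: less_induct)
  case (less i)
  show ?case
  proof (cases "i < k")
    case False
    then obtain d where d: "i = d + k" using le_Suc_ex[of k i] by (auto simp: add.commute)
    have "0 = (\<Sum>j\<le>k. v j * y (m + d + j))" using assms(1) by (simp add: annihilates_def)
    also have "\<dots> = (\<Sum>j\<in>{k}. v j * y (m + d + j))"
      by (intro sum.mono_neutral_right) (use less d in \<open>auto simp: add.assoc\<close>)
    finally show ?thesis using assms(2) by (simp add: d add.assoc)
  qed (use assms in auto)
qed

lemma annihilates_zero_backward:
  assumes "annihilates k v y" "v 0 \<noteq> 0" "\<And>i. i \<ge> m \<Longrightarrow> y i = 0"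
  shows "y i = 0"
  using assms(3)
proof (induction m)
  case (Suc m)
  have "0 = (\<Sum>j\<le>k. v j * y (m + j))" using assms(1) by (simp add: annihilates_def)
  also have "\<dots> = (\<Sum>j\<in>{0}. v j * y (m + j))"
    by (intro sum.mono_neutral_right) (use Suc.prems in auto)
  finally have "y m = 0" using assms(2) by simp
  then show ?case using Suc by (metis le_antisym not_less_eq_eq)
qed simp

text \<open>Take the least order of a nontrivial relation. The last conclusion says that the shifts
  of \<open>y\<close> by \<open>j < k\<close> are linearly independent; it forces
  \<open>v k \<noteq> 0\<close>, since otherwise \<open>v\<close> would be a relation among
  them.\<close>

lemma minimal_annihilator:
  assumes "annihilates K b y" "b 0 \<noteq> 0"
  obtains k v where "annihilates k v y" "v k \<noteq> 0"
    "\<forall>w. (\<forall>n. (\<Sum>j<k. w j * y (n + j)) = 0) \<longrightarrow> (\<forall>j<k. w j = 0)"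
proof -
  define P where "P k \<longleftrightarrow> (\<exists>v. annihilates k v y \<and> (\<exists>j\<le>k. v j \<noteq> 0))" for k
  define k where "k = (LEAST k. P k)"
  have "P K" using assms unfolding P_def by blast
  then have "P k" unfolding k_def by (rule LeastI)
  then obtain v where v: "annihilates k v y" "\<exists>j\<le>k. v j \<noteq> 0" unfolding P_def by blast
  have indep: "w j = 0" if w: "\<And>n. (\<Sum>j<k. w j * y (n + j)) = 0" and "j < k" for w j
  proof (rule ccontr)
    assume "w j \<noteq> 0"
    obtain k' where k': "k = Suc k'" using \<open>j < k\<close> by (cases k) auto
    have "P k'" unfolding P_def annihilates_def
      using w \<open>w j \<noteq> 0\<close> \<open>j < k\<close> by (auto simp: k' lessThan_Suc_atMost less_Suc_eq_le)
    then have "k \<le> k'" unfolding k_def by (rule Least_le)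
    then show False by (simp add: k')
  qed
  have "v k \<noteq> 0"
  proof
    assume "v k = 0"
    then have "(\<Sum>j<k. v j * y (n + j)) = 0" for n
      using v(1) by (simp add: annihilates_def flip: lessThan_Suc_atMost)
    then have "v j = 0" if "j < k" for j using indep that by blast
    with v(2) \<open>v k = 0\<close> show False by (metis le_neq_implies_less)
  qed
  then show ?thesis using v(1) indep by (intro that[of k v]) auto
qed

section \<open>Hankel determinants of a recurrent sequence\<close>

definition hankel :: "(nat \<Rightarrow> 'a) \<Rightarrow> nat \<Rightarrow> nat \<Rightarrow> 'a mat" where
  "hankel y k n = mat k k (\<lambda>(i, j). y (n + i + j))"

lemma hankel_carrier [simp]: "hankel y k n \<in> carrier_mat k k"
  by (simp add: hankel_def)

lemma det_hankel_of_int: "det (hankel (\<lambda>l. of_int (u l)) k n) = (of_int (det (hankel u k n)) :: real)"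
proof -
  have "hankel (\<lambda>l. of_int (u l)) k n = map_mat real_of_int (hankel u k n)"
    by (rule eq_matI) (auto simp: hankel_def)
  then show ?thesis by (simp add: of_int_hom.hom_det)
qed

text \<open>A kernel vector gives a combination \<open>z\<close> of shifts of \<open>y\<close> that
  vanishes at \<open>k\<close> consecutive indices. The recurrence \<open>v\<close> carries the
  zeros forward and \<open>b\<close>, having \<open>b 0 \<noteq> 0\<close>, carries them backward,
  so \<open>z\<close> vanishes identically, against independence.\<close>

lemma det_hankel_nonzero:
  assumes "annihilates K b y" "b 0 \<noteq> 0" "annihilates k v y" "v k \<noteq> 0"
    and indep: "\<forall>w. (\<forall>n. (\<Sum>j<k. w j * y (n + j)) = 0) \<longrightarrow> (\<forall>j<k. w j = 0)"
  shows "det (hankel y k n) \<noteq> 0"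
proof
  assume "det (hankel y k n) = 0"
  then obtain w where w: "w \<in> carrier_vec k" "w \<noteq> 0\<^sub>v k" "hankel y k n *\<^sub>v w = 0\<^sub>v k"
    using det_0_iff_vec_prod_zero[of "hankel y k n" k] by auto
  define z where "z m = (\<Sum>j<k. w $ j * y (m + j))" for m
  have z: "annihilates l x z" if "annihilates l x y" for l x
    using annihilates_shift_combination[OF that, where s = "\<lambda>j. j"] unfolding z_def .
  have "z (n + i) = 0" if "i < k" for i
  proof -
    have "z (n + i) = (hankel y k n *\<^sub>v w) $ i"
      using that w(1) by (auto simp: z_def hankel_def scalar_prod_def atLeast0LessThan mult.commute intro!: sum.cong)
    then show ?thesis using w(3) that by simp
  qed
  then have "z (n + i) = 0" for i
    by (rule annihilates_zero_forward[OF z[OF assms(3)] assms(4)])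
  then have "z i = 0" if "n \<le> i" for i
    using that by (metis le_add_diff_inverse)
  then have "z i = 0" for i
    by (rule annihilates_zero_backward[OF z[OF assms(1)] assms(2)])
  then have "w $ j = 0" if "j < k" for j
    using indep[rule_format, of "\<lambda>j. w $ j" j] that by (simp add: z_def)
  then have "w = 0\<^sub>v k" using w(1) by (intro eq_vecI) auto
  with w(2) show False ..
qed

lemma det_hankel_geometric:
  assumes "annihilates k v y" "v k \<noteq> 0"
  shows "\<exists>\<beta>. \<forall>n. det (hankel y k n) = \<beta> ^ n * det (hankel y k 0)"
proof -
  \<comment> \<open>The companion matrix of \<open>v\<close>: multiplying by it advances the window
    by one index, so the ratio is \<open>det A\<close>.\<close>
  define A where "A = mat k k (\<lambda>(j, l). if Suc l < k then (if j = Suc l then 1 else 0) else - v j / v k)"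
  have A: "A \<in> carrier_mat k k" by (simp add: A_def)
  have step: "hankel y k (Suc n) = hankel y k n * A" for n
  proof (rule eq_matI)
    fix i l assume "i < dim_row (hankel y k n * A)" "l < dim_col (hankel y k n * A)"
    then have il: "i < k" "l < k" by (auto simp: hankel_def A_def)
    have "(hankel y k n * A) $$ (i, l) = (\<Sum>j<k. y (n + i + j) * A $$ (j, l))"
      using il by (simp add: hankel_def A_def scalar_prod_def atLeast0LessThan)
    also have "\<dots> = y (n + i + Suc l)"
    proof (cases "Suc l < k")
      case True
      then have "(\<Sum>j<k. y (n + i + j) * A $$ (j, l)) = (\<Sum>j\<in>{Suc l}. y (n + i + j) * A $$ (j, l))"
        using il by (intro sum.mono_neutral_right) (auto simp: A_def)
      then show ?thesis using True il by (simp add: A_def)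
    next
      case False
      then have l: "Suc l = k" using il by simp
      have "(\<Sum>j<k. v j * y (n + i + j)) + v k * y (n + i + k) = 0"
        using assms(1) by (simp add: annihilates_def flip: lessThan_Suc_atMost)
      then have "y (n + i + k) = - (\<Sum>j<k. v j * y (n + i + j)) / v k"
        using assms(2) by (simp add: field_simps)
      also have "\<dots> = (\<Sum>j<k. y (n + i + j) * A $$ (j, l))"
        using il False by (simp add: A_def sum_divide_distrib mult.commute flip: sum_negf)
      finally show ?thesis by (simp add: l)
    qed
    finally show "hankel y k (Suc n) $$ (i, l) = (hankel y k n * A) $$ (i, l)"
      using il by (simp add: hankel_def)
  qed (simp_all add: hankel_def A_def)
  have "det (hankel y k n) = det A ^ n * det (hankel y k 0)" for n
    by (induction n) (simp_all add: step det_mult[OF hankel_carrier A])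
  then show ?thesis by blast
qed

lemma det_hankel_le:
  fixes y :: "nat \<Rightarrow> real"
  assumes "\<And>l. n \<le> l \<Longrightarrow> l \<le> n + 2 * k \<Longrightarrow> \<bar>y l\<bar> \<le> M"
  shows "\<bar>det (hankel y k n)\<bar> \<le> fact k * M ^ k"
proof -
  have "\<bar>\<Prod>i = 0..<k. hankel y k n $$ (i, p i)\<bar> \<le> M ^ k" if p: "p permutes {0..<k}" for p
  proof -
    have "\<bar>hankel y k n $$ (i, p i)\<bar> \<le> M" if "i < k" for i
      using that permutes_in_image[OF p, of i] assms[of "n + i + p i"] by (simp add: hankel_def)
    then have "(\<Prod>i = 0..<k. \<bar>hankel y k n $$ (i, p i)\<bar>) \<le> (\<Prod>i = 0..<k. M)"
      by (intro prod_mono) auto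
    then show ?thesis by (simp add: abs_prod)
  qed
  then show ?thesis
    by (subst det_def'[OF hankel_carrier]) (rule abs_signed_permutation_sum_le)
qed

text \<open>Pigeonhole: two windows of \<open>K\<close> residues coincide, and the recurrence
  propagates the coincidence forward.\<close>

lemma recurrence_eventually_periodic_mod:
  fixes u c :: "nat \<Rightarrow> int"
  assumes rec: "\<And>n. u (n + K) = (\<Sum>i=1..K. c i * u (n + K - i))" and "m > 0"
  obtains n1 T where "T > 0" "\<And>n. n \<ge> n1 \<Longrightarrow> m dvd u (n + T) - u n"
proof -
  define f where "f n = map (\<lambda>i. u (n + i) mod m) [0..<K]" for n
  have "range f \<subseteq> {xs. set xs \<subseteq> {0..<m} \<and> length xs = K}"
    using \<open>m > 0\<close> by (auto simp: f_def)
  then have "finite (range f)"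
    using finite_lists_length_eq[of "{0..<m}" K] finite_subset by blast
  then have "\<not> inj f" using finite_imageD infinite_UNIV_nat by blast
  then obtain a b where ab: "a < b" "f a = f b"
    by (metis injI linorder_neqE_nat)
  have "m dvd u (b + i) - u (a + i)" for i
  proof (induction i rule: less_induct)
    case (less i)
    show ?case
    proof (cases "i < K")
      case True
      then have "f b ! i = f a ! i" using ab by simp
      then show ?thesis using True by (simp add: f_def mod_eq_dvd_iff)
    next
      case False
      then obtain d where d: "i = d + K" using le_Suc_ex[of K i] by (auto simp: add.commute)
      have "u (b + i) - u (a + i) = (\<Sum>j=1..K. c j * (u (b + d + K - j) - u (a + d + K - j)))"
        using rec[of "b + d"] rec[of "a + d"]
        by (simp add: d add.assoc sum_subtractf right_diff_distrib)
      also have "m dvd \<dots>"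
      proof (intro dvd_sum dvd_mult)
        fix j assume "j \<in> {1..K}"
        then have "b + d + K - j = b + (i - j)" "a + d + K - j = a + (i - j)" "i - j < i"
          by (auto simp: d)
        then show "m dvd u (b + d + K - j) - u (a + d + K - j)" using less.IH by simp
      qed
      finally show ?thesis .
    qed
  qed
  then have "m dvd u (n + (b - a)) - u n" if "n \<ge> a" for n
    using that ab(1) le_Suc_ex[OF that] by (auto simp: add.commute)
  then show ?thesis using ab(1) by (intro that[of "b - a" a]) auto
qed

text \<open>If the Hankel determinants did not grow, they would have constant absolute value \<open>D\<close>. Inverting
  the Hankel matrix would then carry periodicity modulo \<open>2 * D\<close> at large indices back to
  periodicity modulo 2 at index 0.\<close>

proposition odd_recurrence_grows:
  fixes u c :: "nat \<Rightarrow> int"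
  assumes "c K \<noteq> 0" and rec: "\<And>n. u (n + K) = (\<Sum>i=1..K. c i * u (n + K - i))"
    and even: "even (u 0)" and odd: "\<And>n. n > 0 \<Longrightarrow> odd (u n)"
  shows "\<exists>\<rho>>1. \<exists>W n0. \<forall>n\<ge>n0. \<exists>l. n \<le> l \<and> l \<le> n + W \<and> \<rho> ^ n \<le> \<bar>real_of_int (u l)\<bar>"
proof -
  define y where "y l = real_of_int (u l)" for l
  \<comment> \<open>The recurrence with all terms on one side and indices counted upwards; thus
    \<open>b 0\<close> is the last coefficient \<open>c K\<close>.\<close>
  define b where "b j = (if j = K then - 1 else real_of_int (c (K - j)))" for j
  have "K > 0"
  proof (rule ccontr)
    assume "\<not> K > 0"
    then have "u 1 = 0" using rec[of 1] by simp
    then show False using odd[of 1] by simp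
  qed
  have annb: "annihilates K b y"
    unfolding annihilates_def
  proof
    fix n
    have "(\<Sum>j<K. c (K - j) * u (n + j)) = (\<Sum>i=1..K. c i * u (n + K - i))"
      by (rule sum.reindex_bij_witness[of _ "\<lambda>i. K - i" "\<lambda>i. K - i"]) auto
    then have "(\<Sum>j<K. real_of_int (c (K - j)) * y (n + j)) = y (n + K)"
      unfolding y_def rec by (simp flip: of_int_mult of_int_sum)
    moreover have "(\<Sum>j<K. b j * y (n + j)) = (\<Sum>j<K. real_of_int (c (K - j)) * y (n + j))"
      by (intro sum.cong) (auto simp: b_def)
    ultimately show "(\<Sum>j\<le>K. b j * y (n + j)) = 0"
      by (simp add: b_def flip: lessThan_Suc_atMost)
  qed
  have b0: "b 0 \<noteq> 0" using \<open>K > 0\<close> assms(1) by (simp add: b_def)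
  obtain k v where v: "annihilates k v y" "v k \<noteq> 0"
    and indep: "\<forall>w. (\<forall>n. (\<Sum>j<k. w j * y (n + j)) = 0) \<longrightarrow> (\<forall>j<k. w j = 0)"
    by (rule minimal_annihilator[OF annb b0])
  define C where "C n = det (hankel u k n)" for n
  have C: "det (hankel y k n) = of_int (C n)" for n
    unfolding C_def y_def by (rule det_hankel_of_int)
  have C_nz: "C n \<noteq> 0" for n
    using det_hankel_nonzero[OF annb b0 v indep, of n] C by simp
  have C_ge1: "\<bar>real_of_int (C n)\<bar> \<ge> 1" for n
    using C_nz[of n] by linarith
  obtain \<beta> where \<beta>: "real_of_int (C n) = \<beta> ^ n * real_of_int (C 0)" for n
    using det_hankel_geometric[OF v] C by metis
  have "\<bar>\<beta>\<bar> \<ge> 1"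
  proof (rule ccontr)
    assume "\<not> \<bar>\<beta>\<bar> \<ge> 1"
    then have "(\<lambda>n. \<bar>\<beta>\<bar> ^ n * \<bar>real_of_int (C 0)\<bar>) \<longlonglongrightarrow> 0 * \<bar>real_of_int (C 0)\<bar>"
      by (intro tendsto_mult LIMSEQ_power_zero tendsto_const) auto
    then have "\<forall>\<^sub>F n in sequentially. \<bar>\<beta>\<bar> ^ n * \<bar>real_of_int (C 0)\<bar> < 1"
      by (intro order_tendstoD(2)) auto
    then obtain n where "\<bar>\<beta>\<bar> ^ n * \<bar>real_of_int (C 0)\<bar> < 1"
      by (auto simp: eventually_sequentially)
    then show False using C_ge1[of n] \<beta>[of n] by (simp add: abs_mult power_abs)
  qed
  moreover have "\<bar>\<beta>\<bar> \<noteq> 1"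
  proof
    assume "\<bar>\<beta>\<bar> = 1"
    then have "\<bar>real_of_int (C n)\<bar> = \<bar>real_of_int (C 0)\<bar>" for n
      using \<beta>[of n] by (simp add: abs_mult power_abs)
    then have C_const: "\<bar>C n\<bar> = \<bar>C 0\<bar>" for n by (metis of_int_abs of_int_eq_iff)
    have "2 * \<bar>C 0\<bar> > 0" using C_nz[of 0] by simp
    then obtain n1 T where T: "T > 0" "\<And>n. n \<ge> n1 \<Longrightarrow> 2 * \<bar>C 0\<bar> dvd u (n + T) - u n"
      using recurrence_eventually_periodic_mod[of u K c "2 * \<bar>C 0\<bar>"] rec by metis
    define H where "H = hankel u k n1"
    have H: "H \<in> carrier_mat k k" by (simp add: H_def)
    \<comment> \<open>The adjugate replaces the inverse so that \<open>\<mu>\<close> has integer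
      entries.\<close>
    define \<mu> where "\<mu> = adj_mat H *\<^sub>v vec k u"
    have \<mu>: "\<mu> \<in> carrier_vec k" using adj_mat(1)[OF H] by (simp add: \<mu>_def)
    have "H *\<^sub>v \<mu> = (H * adj_mat H) *\<^sub>v vec k u"
      unfolding \<mu>_def using H adj_mat(1)[OF H] by (simp add: assoc_mult_mat_vec[of _ k k _ k])
    also have "\<dots> = C n1 \<cdot>\<^sub>v vec k u"
      using adj_mat(2)[OF H] by (auto simp: C_def H_def)
    finally have H\<mu>: "H *\<^sub>v \<mu> = C n1 \<cdot>\<^sub>v vec k u" .
    \<comment> \<open>Slot \<open>k\<close> of the sum holds the unshifted term
      \<open>- C n1 * u i\<close>. Since \<open>z\<close> vanishes for \<open>i < k\<close> and
      obeys the recurrence, it vanishes everywhere, which recovers \<open>u i\<close> from terms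
      beyond \<open>n1\<close>.\<close>
    define z where "z i = (\<Sum>j\<in>{..k}. (if j < k then real_of_int (\<mu> $ j) else - of_int (C n1))
       * y (i + (if j < k then n1 + j else 0)))" for i
    have z_alt: "z i = of_int ((\<Sum>j<k. \<mu> $ j * u (n1 + i + j)) - C n1 * u i)" for i
      by (simp add: z_def y_def ac_simps flip: lessThan_Suc_atMost)
    have "annihilates k v z"
      unfolding z_def by (rule annihilates_shift_combination[OF v(1)])
    moreover have "z (0 + i) = 0" if "i < k" for i
    proof -
      have "(H *\<^sub>v \<mu>) $ i = (\<Sum>j<k. \<mu> $ j * u (n1 + i + j))"
        using that \<mu> by (auto simp: H_def hankel_def scalar_prod_def atLeast0LessThan mult.commute intro!: sum.cong)
      then show ?thesis using that by (simp add: z_alt H\<mu>)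
    qed
    ultimately have "z (0 + i) = 0" for i
      using annihilates_zero_forward[of k v z 0 i] v(2) by blast
    then have "(\<Sum>j<k. \<mu> $ j * u (n1 + i + j)) - C n1 * u i = 0" for i
      using z_alt[of i] by (simp only: add_0 of_int_eq_0_iff)
    then have recover: "C n1 * u i = (\<Sum>j<k. \<mu> $ j * u (n1 + i + j))" for i
      by (simp add: eq_diff_eq')
    have "C n1 * (u T - u 0) = (\<Sum>j<k. \<mu> $ j * (u (n1 + j + T) - u (n1 + j)))"
      using recover[of T] recover[of 0] by (simp add: right_diff_distrib sum_subtractf ac_simps)
    also have "2 * \<bar>C 0\<bar> dvd \<dots>" using T(2) by (intro dvd_sum dvd_mult) auto
    \<comment> \<open>The modulus \<open>2 * \<bar>C 0\<bar>\<close> equals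
      \<open>2 * \<bar>C n1\<bar>\<close>, so cancelling \<open>C n1\<close> leaves divisibility by
      2.\<close>
    finally have "\<bar>C n1 * 2\<bar> dvd C n1 * (u T - u 0)"
      unfolding abs_mult abs_numeral C_const[of n1] by (simp only: mult.commute)
    then have "C n1 * 2 dvd C n1 * (u T - u 0)" by (simp only: abs_dvd_iff)
    then have "even (u T - u 0)" using C_nz by simp
    then show False using even odd[OF T(1)] by simp
  qed
  ultimately have \<beta>1: "\<bar>\<beta>\<bar> > 1" by simp
  \<comment> \<open>Splits \<open>\<bar>\<beta>\<bar> ^ n\<close> into two factors
    \<open>r ^ n\<close>: one absorbs \<open>fact k\<close>, the other is
    \<open>(\<rho> ^ n) ^ k\<close>, the size of a product of \<open>k\<close> entries.\<close>
  define r where "r = sqrt \<bar>\<beta>\<bar>"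
  have r: "r > 1" "r * r = \<bar>\<beta>\<bar>" using \<beta>1 by (simp_all add: r_def)
  have "k > 0"
  proof (rule ccontr)
    assume "\<not> k > 0"
    then have "C n = 1" for n by (simp add: C_def)
    then show False using \<beta>[of 1] \<beta>1 by simp
  qed
  define \<rho> where "\<rho> = root k r"
  have \<rho>: "\<rho> > 1" "\<rho> ^ k = r" using r \<open>k > 0\<close> by (simp_all add: \<rho>_def)
  obtain n0 where n0: "fact k < r ^ n0" using real_arch_pow[OF r(1)] by blast
  have "\<exists>l. n \<le> l \<and> l \<le> n + 2 * k \<and> \<rho> ^ n \<le> \<bar>y l\<bar>" if "n \<ge> n0" for n
  proof (rule ccontr)
    assume "\<not> ?thesis"
    then have "\<bar>y l\<bar> \<le> \<rho> ^ n" if "n \<le> l" "l \<le> n + 2 * k" for l using that by force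
    then have "\<bar>det (hankel y k n)\<bar> \<le> fact k * (\<rho> ^ n) ^ k" by (rule det_hankel_le)
    also have "(\<rho> ^ n) ^ k = r ^ n" by (simp add: \<rho>(2) flip: power_mult) (simp add: mult.commute power_mult \<rho>(2))
    also have "fact k * r ^ n < r ^ n * r ^ n"
    proof -
      have "fact k < r ^ n" using n0 power_increasing[OF that, of r] r(1) by linarith
      then show ?thesis using r(1) by simp
    qed
    also have "\<dots> = \<bar>\<beta>\<bar> ^ n" by (simp add: r(2) flip: power_mult_distrib)
    also have "\<dots> \<le> \<bar>\<beta>\<bar> ^ n * \<bar>real_of_int (C 0)\<bar>" using C_ge1[of 0] by (simp add: mult_le_cancel_left1)
    also have "\<dots> = \<bar>det (hankel y k n)\<bar>" by (simp add: C \<beta>[of n] abs_mult power_abs)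
    finally show False by simp
  qed
  then show ?thesis unfolding y_def using \<rho>(1) by blast
qed

subsection \<open>Conclusion\<close>

theorem theorem6:
  shows "\<not> satisfies_linear_recurrence (\<lambda>n. int (gcd (2 ^ n - 1) (fib n)))"
proof
  define g :: "nat \<Rightarrow> nat" where "g n = gcd (2 ^ n - 1) (fib n)" for n
  assume "satisfies_linear_recurrence (\<lambda>n. int (gcd (2 ^ n - 1) (fib n)))"
  then obtain K c where c: "c K \<noteq> 0"
    and rec: "\<And>n. int (g (n + K)) = (\<Sum>i=1..K. c i * int (g (n + K - i)))"
    unfolding satisfies_linear_recurrence_def g_def by blast
  have g_dvd: "g n dvd 2 ^ n - 1" "g n dvd fib n" for n by (simp_all add: g_def)
  have g_odd: "odd (g n)" if "n > 0" for n
  proof -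
    have "odd (2 ^ n - 1 :: nat)" using that by simp
    then show ?thesis using g_dvd(1)[of n] dvd_trans by blast
  qed
  have "even (int (g 0))" "\<And>n. n > 0 \<Longrightarrow> odd (int (g n))"
    using g_odd by (simp_all add: g_def)
  then obtain \<rho> :: real and W n0 where "\<rho> > 1"
    and grow: "\<And>n. n \<ge> n0 \<Longrightarrow> \<exists>l. n \<le> l \<and> l \<le> n + W \<and> \<rho> ^ n \<le> real (g l)"
    using odd_recurrence_grows[of c K "\<lambda>n. int (g n)", OF c rec] by auto
  define \<theta> where "\<theta> = 4 * phi ^ 4"
  have \<theta>: "\<theta> > 0" using phi_gt_1 by (simp add: \<theta>_def)
  obtain q0 where q0: "\<theta> < \<rho> ^ q0" using real_arch_pow[OF \<open>\<rho> > 1\<close>] by blast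
  \<comment> \<open>Ensures \<open>q0 \<le> 2 * (q + 1)\<close> and
    \<open>q - 1 > 0\<close>.\<close>
  define q where "q = q0 + 2"
  define N where "N = q * q"
  define R where "R = N * Suc W"
  define B where "B = (fact N)\<^sup>2 * 4 ^ (R * (\<Sum>l = 0..<N. l div q)) * (phi ^ 4) ^ (R * (\<Sum>l = 0..<N. l mod q))"
  \<comment> \<open>As \<open>N - 1 = (q + 1) * (q - 1)\<close>, the squared product of the values
    of \<open>g\<close> is at least \<open>\<rho> ^ (2 * n * (q + 1) * (q - 1))\<close>, against
    \<open>B * \<theta> ^ (n * (q - 1))\<close> with \<open>B\<close> independent of
    \<open>n\<close>.\<close>
  have bound: "((\<rho> ^ (2 * (q + 1)) / \<theta>) ^ (q - 1)) ^ n \<le> B" if n: "n \<ge> n0" "n > 0" for n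
  proof -
    \<comment> \<open>Starting points of disjoint windows of \<open>Suc W\<close> indices for
      \<open>i > 0\<close>; the shift by 1 reserves row 0 for the index 0.\<close>
    define s where "s i = n + (i - 1) * Suc W" for i
    have "\<exists>l. s i \<le> l \<and> l \<le> s i + W \<and> \<rho> ^ s i \<le> real (g l)" for i
      using grow[of "s i"] n by (simp add: s_def)
    then obtain l where l: "\<And>i. s i \<le> l i" "\<And>i. l i \<le> s i + W" "\<And>i. \<rho> ^ s i \<le> real (g (l i))"
      by metis
    define t where "t i = (if i = 0 then 0 else l i)" for i
    have t_less: "t i < t j" if "i < j" for i j
    proof (cases "i = 0")
      case True
      then show ?thesis using that l(1)[of j] n(2) by (simp add: t_def s_def)
    next
      case False
      have "l i \<le> n + (i - 1) * Suc W + W" using l(2)[of i] by (simp add: s_def)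
      also have "\<dots> < n + Suc (i - 1) * Suc W" by simp
      also have "\<dots> \<le> n + (j - 1) * Suc W"
        using that False by (intro add_left_mono mult_right_mono) auto
      also have "\<dots> \<le> l j" using l(1)[of j] by (simp add: s_def)
      finally show ?thesis using that False by (simp add: t_def)
    qed
    have "inj_on t {..<N}"
      by (rule inj_onI) (metis t_less less_irrefl linorder_neqE_nat)
    moreover have "n \<le> t i \<and> t i \<le> n + R" if "i \<in> {1..<N}" for i
    proof -
      have "Suc (i - 1) * Suc W \<le> N * Suc W"
        using that by (intro mult_right_mono) auto
      then have "s i + W \<le> n + R" by (simp add: s_def R_def)
      moreover have "n \<le> s i" by (simp add: s_def)
      ultimately show ?thesis using that l(1,2)[of i] by (auto simp: t_def)
    qed
    moreover from this have "g (t i) > 0 \<and> odd (g (t i)) \<and> g (t i) dvd 2 ^ t i - 1 \<and> g (t i) dvd fib (t i)"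
      if "i \<in> {1..<N}" for i
      using that g_odd[of "t i"] g_dvd[of "t i"] n(2) by (metis less_le_trans odd_pos)
    ultimately have "(\<Prod>i\<in>{1..<N}. real (g (t i)))\<^sup>2 \<le> B * \<theta> ^ (n * (q - 1))"
      using prod_common_divisors_bound[of q t n R "\<lambda>i. g (t i)"]
      by (simp add: B_def N_def \<theta>_def q_def t_def)
    moreover have "(\<rho> ^ n) ^ (N - 1) \<le> (\<Prod>i\<in>{1..<N}. real (g (t i)))"
    proof -
      have "\<rho> ^ n \<le> real (g (t i))" if "i \<in> {1..<N}" for i
      proof -
        have "\<rho> ^ n \<le> \<rho> ^ s i" using \<open>\<rho> > 1\<close> by (intro power_increasing) (auto simp: s_def)
        also have "\<dots> \<le> real (g (t i))" using l(3)[of i] that by (simp add: t_def)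
        finally show ?thesis .
      qed
      then have "(\<Prod>i\<in>{1..<N}. \<rho> ^ n) \<le> (\<Prod>i\<in>{1..<N}. real (g (t i)))"
        using \<open>\<rho> > 1\<close> by (intro prod_mono) auto
      then show ?thesis by simp
    qed
    then have "((\<rho> ^ n) ^ (N - 1))\<^sup>2 \<le> (\<Prod>i\<in>{1..<N}. real (g (t i)))\<^sup>2"
      using \<open>\<rho> > 1\<close> by (intro power_mono) auto
    ultimately have le: "((\<rho> ^ n) ^ (N - 1))\<^sup>2 \<le> B * \<theta> ^ (n * (q - 1))" by linarith
    have "N - 1 = (q + 1) * (q - 1)" by (simp add: N_def q_def algebra_simps)
    then have "((\<rho> ^ n) ^ (N - 1))\<^sup>2 = ((\<rho> ^ (2 * (q + 1))) ^ (q - 1)) ^ n"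
      by (simp only: ac_simps flip: power_mult)
    then show ?thesis
      using le \<theta> by (simp add: power_divide field_simps flip: power_mult)
  qed
  have "\<theta> < \<rho> ^ (2 * (q + 1))"
    using q0 power_increasing[of q0 "2 * (q + 1)" \<rho>] \<open>\<rho> > 1\<close> by (simp add: q_def)
  then have "(\<rho> ^ (2 * (q + 1)) / \<theta>) ^ (q - 1) > 1"
    using \<theta> by (intro one_less_power) (auto simp: q_def)
  then obtain m where "B < ((\<rho> ^ (2 * (q + 1)) / \<theta>) ^ (q - 1)) ^ m"
    using real_arch_pow by blast
  also have "\<dots> \<le> ((\<rho> ^ (2 * (q + 1)) / \<theta>) ^ (q - 1)) ^ (m + n0 + 1)"
    using \<open>1 < _ ^ (q - 1)\<close> by (intro power_increasing) auto
  also have "\<dots> \<le> B" by (rule bound) auto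
  finally show False by simp
qed

end
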